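(* Let $p_1\neq p_2$ be primes and let $\mu$ be a regular uncountable cardinal less than the first measurable cardinal. Let $N_\mu$ and $e_\alpha$ ($\alpha<\mu$) be as in the context. If $f:N_\mu\to N_\mu$ is a group homomorphism with $f(e_\alpha)=e_\alpha$ for all $\alpha<\mu$, then $f=\operatorname{id}_{N_\mu}$.
   Context: $U_\mu:=\prod_{\alpha<\mu}\mathbb{Q}e_\alpha$ (so $e_\alpha$ has $1$ in coordinate $\alpha$ and $0$ elsewhere); $\mathbb{Z}[1/p_1,1/p_2]$ and $\mathbb{Z}[1/p_2]$ are the subrings of $\mathbb{Q}$ generated by the indicated fractions. $M_\mu:=\bigoplus_{\alpha<\mu}\mathbb{Z}[1/p_1,1/p_2]e_\alpha\le U_\mu$ and $N_\mu$ is the subgroup of $U_\mu$ generated by $M_\mu$ and $\prod_{\alpha<\mu}\mathbb{Z}[1/p_2]e_\alpha$. *)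

theory Defs
  imports
    "HOL-Algebra.Product_Groups"
    "HOL-Algebra.Generated_Rings"
    "HOL-Computational_Algebra.Primes"
begin

unbundle cardinal_syntax

text \<open>
  A cardinal is a relation \<open>r\<close> with \<open>Card_order r\<close>, i.e. an initial ordinal
  realised on the set \<open>Field r\<close>; the indices \<open>\<alpha> < \<mu>\<close> are the elements of \<open>Field r\<close>.
\<close>

definition ultrafilter_on :: "'a set \<Rightarrow> 'a set set \<Rightarrow> bool" where
  "ultrafilter_on A \<U> \<longleftrightarrow>
     \<U> \<subseteq> Pow A \<and> A \<in> \<U> \<and> {} \<notin> \<U> \<and>
     (\<forall>X\<in>\<U>. \<forall>Y\<in>\<U>. X \<inter> Y \<in> \<U>) \<and>
     (\<forall>X\<in>\<U>. \<forall>Y. X \<subseteq> Y \<and> Y \<subseteq> A \<longrightarrow> Y \<in> \<U>) \<and>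
     (\<forall>X. X \<subseteq> A \<longrightarrow> X \<in> \<U> \<or> A - X \<in> \<U>)"

definition nonprincipal_on :: "'a set \<Rightarrow> 'a set set \<Rightarrow> bool" where
  "nonprincipal_on A \<U> \<longleftrightarrow> (\<forall>a\<in>A. {a} \<notin> \<U>)"

definition complete_below :: "'k rel \<Rightarrow> 'a set set \<Rightarrow> bool" where
  "complete_below \<kappa> \<U> \<longleftrightarrow>
     (\<forall>\<F>. \<F> \<subseteq> \<U> \<and> \<F> \<noteq> {} \<and> |\<F>| <o \<kappa> \<longrightarrow> \<Inter>\<F> \<in> \<U>)"

definition measurable_cardinal :: "'a rel \<Rightarrow> bool" where
  "measurable_cardinal \<kappa> \<longleftrightarrow>
     Card_order \<kappa> \<and> natLeq <o \<kappa> \<and>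
     (\<exists>\<U>. ultrafilter_on (Field \<kappa>) \<U> \<and> nonprincipal_on (Field \<kappa>) \<U> \<and> complete_below \<kappa> \<U>)"

text \<open>
  Every cardinal \<open>\<kappa> \<le> \<mu>\<close> is realised on a subset of \<open>Field \<mu>\<close>, so it suffices to let
  \<open>\<kappa>\<close> range over relations on the same type. If there is no measurable cardinal
  at all, the condition is vacuous.
\<close>

definition below_first_measurable :: "'a rel \<Rightarrow> bool" where
  "below_first_measurable \<mu> \<longleftrightarrow> \<not> (\<exists>\<kappa> :: 'a rel. measurable_cardinal \<kappa> \<and> \<kappa> \<le>o \<mu>)"

definition rat_ring :: "rat ring" where
  "rat_ring = \<lparr>carrier = UNIV, monoid.mult = (*), one = 1, zero = 0, add = (+)\<rparr>"

definition Z_inv :: "nat set \<Rightarrow> rat set" where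
  "Z_inv P = generate_ring rat_ring ((\<lambda>p. 1 / of_nat p) ` P)"

definition U_group :: "'a rel \<Rightarrow> ('a \<Rightarrow> rat) monoid" where
  "U_group \<mu> = product_group (Field \<mu>) (\<lambda>_. add_monoid rat_ring)"

definition e_vec :: "'a rel \<Rightarrow> 'a \<Rightarrow> ('a \<Rightarrow> rat)" where
  "e_vec \<mu> \<alpha> = (\<lambda>\<beta>\<in>Field \<mu>. if \<beta> = \<alpha> then 1 else 0)"

definition M_set :: "nat \<Rightarrow> nat \<Rightarrow> 'a rel \<Rightarrow> ('a \<Rightarrow> rat) set" where
  "M_set p\<^sub>1 p\<^sub>2 \<mu> =
     carrier (sum_group (Field \<mu>) (\<lambda>_. (add_monoid rat_ring)\<lparr>carrier := Z_inv {p\<^sub>1, p\<^sub>2}\<rparr>))"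

definition N_group :: "nat \<Rightarrow> nat \<Rightarrow> 'a rel \<Rightarrow> ('a \<Rightarrow> rat) monoid" where
  "N_group p\<^sub>1 p\<^sub>2 \<mu> =
     subgroup_generated (U_group \<mu>) (M_set p\<^sub>1 p\<^sub>2 \<mu> \<union> (\<Pi>\<^sub>E \<alpha>\<in>Field \<mu>. Z_inv {p\<^sub>2}))"

end

theory Submission
  imports Defs "HOL-Library.Countable_Set_Type"
begin

text \<open>
  Since \<open>f\<close> fixes every \<open>e\<^sub>\<alpha>\<close> and the groups are torsion-free, it fixes \<open>M\<close>. Hence each coordinate
  of \<open>f - id\<close> is an additive map \<open>g\<close> from the full power of \<open>\<int>[1/p\<^sub>2]\<close> to \<open>\<int>[1/p\<^sub>1, 1/p\<^sub>2]\<close> that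
  kills the vectors with one nonzero entry, and the claim is Los's theorem on slender groups for
  \<open>g\<close>. The target contains no nonzero element that is infinitely divisible by a prime
  \<open>q \<notin> {p\<^sub>1, p\<^sub>2}\<close>; therefore the sets \<open>X\<close> such that \<open>g\<close> vanishes on all vectors supported on \<open>X\<close> form
  a \<open>\<sigma>\<close>-ideal, and there is no infinite disjoint family of sets outside it. If \<open>g \<noteq> 0\<close>, some set
  outside the ideal is an atom, the ideal becomes prime on it, and the least size of a family in
  this prime ideal whose union is not in it is a measurable cardinal that is at most \<open>\<mu>\<close>.
\<close>

section \<open>Additive maps from integer sequences to the rationals\<close>

text \<open>The case \<open>k = 0\<close> forces \<open>x\<close> into \<open>R\<close>, so this
  says that the sets \<open>q ^ k * R\<close> have no common element except possibly 0.\<close>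

definition reduced_at :: "int \<Rightarrow> rat set \<Rightarrow> bool" where
  "reduced_at q R \<longleftrightarrow> (\<forall>x. (\<forall>k. \<exists>y\<in>R. x = of_int q ^ k * y) \<longrightarrow> x = 0)"

lemma additive_seq_int_mult:
  fixes \<phi> :: "(nat \<Rightarrow> int) \<Rightarrow> rat"
  assumes add: "\<And>x y. \<phi> (\<lambda>n. x n + y n) = \<phi> x + \<phi> y"
  shows "\<phi> (\<lambda>n. k * x n) = of_int k * \<phi> x"
proof -
  have zero: "\<phi> (\<lambda>n. 0) = 0"
    using add[of "\<lambda>n. 0" "\<lambda>n. 0"] by simp
  have nat: "\<phi> (\<lambda>n. int m * y n) = of_nat m * \<phi> y" for m y
  proof (induction m)
    case 0
    then show ?case using zero by simp
  next
    case (Suc m)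
    then show ?case
      using add[of "\<lambda>n. int m * y n" y] by (simp add: algebra_simps)
  qed
  have neg: "\<phi> (\<lambda>n. - y n) = - \<phi> y" for y
    using add[of y "\<lambda>n. - y n"] zero by simp
  show ?thesis
  proof (cases "k \<ge> 0")
    case True
    then show ?thesis using nat[of "nat k" x] by simp
  next
    case False
    then show ?thesis using nat[of "nat (- k)" "\<lambda>n. - x n"] neg[of x] by simp
  qed
qed

lemma additive_seq_finite_support:
  fixes \<phi> :: "(nat \<Rightarrow> int) \<Rightarrow> rat"
  assumes add: "\<And>x y. \<phi> (\<lambda>n. x n + y n) = \<phi> x + \<phi> y"
    and unit: "\<And>n. n < m \<Longrightarrow> \<phi> (\<lambda>i. if i = n then 1 else 0) = 0"
  shows "\<phi> (\<lambda>n. if n < m then x n else 0) = 0"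
  using unit
proof (induction m)
  case 0
  then show ?case using add[of "\<lambda>n. 0" "\<lambda>n. 0"] by simp
next
  case (Suc m)
  have "(\<lambda>n. if n < Suc m then x n else 0) =
      (\<lambda>n. (if n < m then x n else 0) + x m * (if n = m then 1 else 0))"
    by (auto simp: fun_eq_iff less_Suc_eq)
  then show ?case
    using Suc additive_seq_int_mult[of \<phi> "x m" "\<lambda>n. if n = m then 1 else 0"]
    by (simp add: add)
qed

text \<open>Deleting the first \<open>k\<close> terms does not change the value, and what remains is
  \<open>q ^ k\<close> times an integer sequence; so the value is divisible by \<open>q ^ k\<close>
  inside \<open>R\<close> for every \<open>k\<close>.\<close>

lemma additive_seq_powers_eq_0:
  fixes \<phi> :: "(nat \<Rightarrow> int) \<Rightarrow> rat"
  assumes add: "\<And>x y. \<phi> (\<lambda>n. x n + y n) = \<phi> x + \<phi> y"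
    and R: "\<And>x. \<phi> x \<in> R" and red: "reduced_at q R"
    and unit: "\<And>n. \<phi> (\<lambda>i. if i = n then 1 else 0) = 0"
  shows "\<phi> (\<lambda>n. q ^ n * b n) = 0"
proof -
  have "\<exists>y\<in>R. \<phi> (\<lambda>n. q ^ n * b n) = of_int q ^ k * y" for k
  proof -
    define t where "t n = (if n < k then 0 else q ^ (n - k) * b n)" for n
    have split: "(\<lambda>n. q ^ n * b n) = (\<lambda>n. (if n < k then q ^ n * b n else 0) + q ^ k * t n)"
      by (auto simp: fun_eq_iff t_def simp flip: power_add mult.assoc)
    have "\<phi> (\<lambda>n. q ^ n * b n) = of_int q ^ k * \<phi> t"
      using additive_seq_finite_support[OF add unit, where m = k and x = "\<lambda>n. q ^ n * b n"]
      by (subst split) (simp add: add additive_seq_int_mult[of \<phi>])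
    then show ?thesis using R by blast
  qed
  then show ?thesis using red unfolding reduced_at_def by blast
qed

text \<open>Writing \<open>c n = q ^ n * b n + q' ^ n * d n\<close>, both summands are sent to infinitely divisible
  elements.\<close>

lemma additive_seq_eq_0:
  fixes \<phi> :: "(nat \<Rightarrow> int) \<Rightarrow> rat"
  assumes add: "\<And>x y. \<phi> (\<lambda>n. x n + y n) = \<phi> x + \<phi> y"
    and R: "\<And>x. \<phi> x \<in> R" and red: "reduced_at q R" "reduced_at q' R" and "coprime q q'"
    and unit: "\<And>n. \<phi> (\<lambda>i. if i = n then 1 else 0) = 0"
  shows "\<phi> c = 0"
proof -
  have "\<exists>b d. c n = q ^ n * b + q' ^ n * d" for n
  proof -
    have "coprime (q ^ n) (q' ^ n)" using \<open>coprime q q'\<close> by simp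
    then obtain u v where "u * q ^ n + v * q' ^ n = 1"
      using bezout_int[of "q ^ n" "q' ^ n"] by auto
    then have "c n = (u * q ^ n + v * q' ^ n) * c n" by simp
    also have "\<dots> = q ^ n * (u * c n) + q' ^ n * (v * c n)" by (simp only: algebra_simps)
    finally show ?thesis by blast
  qed
  then obtain b d where "\<And>n. c n = q ^ n * b n + q' ^ n * d n" by metis
  then have "c = (\<lambda>n. q ^ n * b n + q' ^ n * d n)" by blast
  then show ?thesis
    using add additive_seq_powers_eq_0[OF add R red(1) unit, of b]
      additive_seq_powers_eq_0[OF add R red(2) unit, of d] by simp
qed

text \<open>For rapidly increasing \<open>k\<close>, the map \<open>\<phi>\<close> is injective on the uncountably many sequences
  with entries \<open>0\<close> or \<open>q ^ k n\<close>, but the target is countable.\<close>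

lemma additive_seq_some_unit_eq_0:
  fixes \<phi> :: "(nat \<Rightarrow> int) \<Rightarrow> rat"
  assumes add: "\<And>x y. \<phi> (\<lambda>n. x n + y n) = \<phi> x + \<phi> y"
    and R: "\<And>x. \<phi> x \<in> R" and red: "reduced_at q R" and "q \<noteq> 0"
  shows "\<exists>n. \<phi> (\<lambda>i. if i = n then 1 else 0) = 0"
proof (rule ccontr)
  define r where "r n = \<phi> (\<lambda>i. if i = n then 1 else 0)" for n
  assume "\<not> ?thesis"
  then have r: "r n \<noteq> 0" for n by (simp add: r_def)
  note scale = additive_seq_int_mult[of \<phi>, OF add]
  \<comment> \<open>As \<open>r n\<close> is nonzero, some power \<open>q ^ l\<close> does not
    divide it within \<open>R\<close>; both sides are then multiplied by
    \<open>q ^ j\<close>.\<close>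
  have "\<exists>l. \<forall>x. of_int q ^ j * r n \<noteq> of_int q ^ (j + l) * \<phi> x" for j n
  proof -
    have "\<not> (\<forall>k. \<exists>y\<in>R. r n = of_int q ^ k * y)"
      using red r unfolding reduced_at_def by blast
    then obtain l where "\<forall>y\<in>R. r n \<noteq> of_int q ^ l * y" by blast
    then show ?thesis using R \<open>q \<noteq> 0\<close> by (intro exI[of _ l]) (auto simp: power_add)
  qed
  then obtain l where l: "\<And>j n x. of_int q ^ j * r n \<noteq> of_int q ^ (j + l j n) * \<phi> x"
    by metis
  \<comment> \<open>The gap from \<open>k n\<close> to \<open>k (Suc n)\<close> is chosen so that
    \<open>q ^ k n * r n\<close> is not \<open>q ^ k (Suc n)\<close> times a value of
    \<phi>.\<close>
  define k where "k = rec_nat 0 (\<lambda>n j. j + l j n)"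
  have kSuc: "k (Suc n) = k n + l (k n) n" for n by (simp add: k_def)
  have kmono: "k m \<le> k n" if "m \<le> n" for m n
    using that by (rule lift_Suc_mono_le[rotated]) (simp add: kSuc)
  define s where "s A n = (if n \<in> A then q ^ k n else 0)" for A :: "nat set" and n
  have "inj (\<lambda>A. \<phi> (s A))"
  proof (rule injI, rule ccontr)
    fix A B assume eq: "\<phi> (s A) = \<phi> (s B)" and "A \<noteq> B"
    then have ex: "\<exists>n. n \<in> A \<longleftrightarrow> n \<notin> B" by blast
    define m where "m = (LEAST n. n \<in> A \<longleftrightarrow> n \<notin> B)"
    have m: "m \<in> A \<longleftrightarrow> m \<notin> B" unfolding m_def by (rule LeastI_ex[OF ex])
    have below: "n \<in> A \<longleftrightarrow> n \<in> B" if "n < m" for n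
      using not_less_Least[OF that[unfolded m_def]] by blast
    \<comment> \<open>At the first difference \<open>m\<close> the two sequences differ by
      \<open>\<epsilon> * q ^ k m\<close>; all later differences are divisible by
      \<open>q ^ k (Suc m)\<close>, with quotient \<open>t\<close>. Equal values would thus
      contradict the choice of \<open>k\<close>.\<close>
    define \<epsilon> :: int where "\<epsilon> = (if m \<in> A then 1 else - 1)"
    define t where "t n = (if n \<le> m then 0 else
        q ^ (k n - k (Suc m)) * ((if n \<in> B then 1 else 0) - (if n \<in> A then 1 else 0)))" for n
    have pw: "q ^ k (Suc m) * q ^ (k n - k (Suc m)) = q ^ k n" if "\<not> n \<le> m" for n
      using kmono[of "Suc m" n] that by (simp flip: power_add)
    have "(\<lambda>n. s A n + q ^ k (Suc m) * t n) =
        (\<lambda>n. s B n + (\<epsilon> * q ^ k m) * (if n = m then 1 else 0))"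
    proof
      fix n
      consider "n < m" | "n = m" | "n > m" by linarith
      then show "s A n + q ^ k (Suc m) * t n =
          s B n + (\<epsilon> * q ^ k m) * (if n = m then 1 else 0)"
      proof cases
        case 1
        then show ?thesis using below by (simp add: s_def t_def)
      next
        case 2
        then show ?thesis using m by (auto simp: s_def t_def \<epsilon>_def)
      next
        case 3
        then show ?thesis using pw[of n] by (simp add: s_def t_def)
      qed
    qed
    then have "\<phi> (s A) + of_int (q ^ k (Suc m)) * \<phi> t = \<phi> (s B) + of_int (\<epsilon> * q ^ k m) * r m"
      by (metis add scale r_def)
    then have "of_int q ^ k (Suc m) * \<phi> t = of_int \<epsilon> * (of_int q ^ k m * r m)"
      using eq by (simp add: mult.assoc)
    then have "of_int q ^ k m * r m = of_int q ^ k (Suc m) * \<phi> (\<lambda>n. \<epsilon> * t n)"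
      unfolding scale by (auto simp: \<epsilon>_def split: if_splits)
    then show False using l[of "k m" m "\<lambda>n. \<epsilon> * t n"] by (simp add: kSuc)
  qed
  then have "inj (to_nat \<circ> (\<lambda>A. \<phi> (s A)))" by (intro inj_compose) auto
  then show False using Cantors_theorem[of "UNIV :: nat set"] 
    by (metis Pow_UNIV inj_imp_surj_inv)
qed

section \<open>From prime ideals of sets to measurable cardinals\<close>

text \<open>Among the index sets of families in \<open>J\<close> with union outside
  \<open>J\<close>, take \<open>S\<close> of least size; the singletons of \<open>I\<close> are such
  a family. The complements of members of \<open>J\<close> form an ultrafilter, and minimality makes
  its image on \<open>S\<close> complete below \<open>|S|\<close>.\<close>

lemma sigma_complete_prime_ideal_measurable:
  fixes J :: "'a set set"
  assumes sub: "\<And>X Y. X \<in> J \<Longrightarrow> Y \<subseteq> X \<Longrightarrow> Y \<in> J"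
    and prime: "\<And>X. X \<in> J \<longleftrightarrow> - X \<notin> J"
    and sigma: "\<And>F :: nat \<Rightarrow> 'a set. (\<And>n. F n \<in> J) \<Longrightarrow> (\<Union>n. F n) \<in> J"
    and single: "\<And>a. {a} \<in> J"
    and "I \<notin> J"
  shows "\<exists>\<kappa> :: 'a rel. measurable_cardinal \<kappa> \<and> \<kappa> \<le>o |I|"
proof -
  have un: "X \<union> Y \<in> J" if "X \<in> J" "Y \<in> J" for X Y
  proof -
    have "(\<Union>n::nat. if n = 0 then X else Y) \<in> J" using that by (intro sigma) auto
    then show ?thesis by (rule sub) (auto split: if_splits intro: exI[of _ 0] exI[of _ 1])
  qed
  have empty: "{} \<in> J" using single sub by blast
  \<comment> \<open>Index sets are taken inside \<open>'a\<close> so that their cardinals have type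
    \<open>'a rel\<close>.\<close>
  define bad where "bad S \<longleftrightarrow> (\<exists>F :: 'a \<Rightarrow> 'a set. (\<forall>s\<in>S. F s \<in> J) \<and> (\<Union>s\<in>S. F s) \<notin> J)"
    for S :: "'a set"
  have "bad I" unfolding bad_def using single \<open>I \<notin> J\<close> by (intro exI[of _ "\<lambda>a. {a}"]) simp
  obtain S where S: "bad S" and min: "\<And>T. bad T \<Longrightarrow> |S| \<le>o |T|"
  proof -
    have "\<exists>r\<in>card_of ` Collect bad. \<forall>r'\<in>card_of ` Collect bad. r \<le>o r'"
      using \<open>bad I\<close> by (intro exists_minim_Card_order) (auto simp: card_of_Card_order)
    then show ?thesis using that by auto
  qed
  then obtain F where F: "\<And>s. s \<in> S \<Longrightarrow> F s \<in> J" and W: "(\<Union>s\<in>S. F s) \<notin> J"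
    unfolding bad_def by blast
  define W where "W = (\<Union>s\<in>S. F s)"
  \<comment> \<open>Choosing one index for each point cuts \<open>W\<close> into disjoint fibres,
    each inside some \<open>F s\<close> and hence in \<open>J\<close>.\<close>
  obtain \<sigma> where \<sigma>: "\<And>x. x \<in> W \<Longrightarrow> \<sigma> x \<in> S \<and> x \<in> F (\<sigma> x)"
  proof
    fix x assume "x \<in> W"
    then have "\<exists>s. s \<in> S \<and> x \<in> F s" by (auto simp: W_def)
    then show "(SOME s. s \<in> S \<and> x \<in> F s) \<in> S \<and> x \<in> F (SOME s. s \<in> S \<and> x \<in> F s)"
      by (rule someI_ex)
  qed
  \<comment> \<open>\<open>P T\<close> is the union of the fibres over \<open>T\<close>, so \<U> is
    the image under \<sigma> of the ultrafilter dual to \<open>J\<close>.\<close>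
  define P where "P T = W \<inter> \<sigma> -` T" for T
  define \<U> where "\<U> = {T. T \<subseteq> S \<and> - P T \<in> J}"
  have PS: "P S = W" using \<sigma> by (auto simp: P_def)
  have uncountable: "natLeq <o |S|"
  proof -
    have "\<not> |S| \<le>o natLeq"
    proof
      assume "|S| \<le>o natLeq"
      then have "countable S" by (simp add: countable_card_le_natLeq)
      then have "(\<Union>s\<in>S. F s) \<in> J"
      proof (cases "S = {}")
        case False
        then have "(\<Union>n. F (from_nat_into S n)) \<in> J"
          by (intro sigma F from_nat_into)
        moreover have "(\<Union>n. F (from_nat_into S n)) = (\<Union>s\<in>S. F s)"
          using range_from_nat_into[OF False \<open>countable S\<close>] by (metis image_image)
        ultimately show ?thesis by simp
      qed (simp add: empty)
      then show False using W by simp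
    qed
    then show ?thesis
      using not_ordLeq_iff_ordLess[OF natLeq_Well_order card_of_Well_order] by blast
  qed
  have ultra: "ultrafilter_on S \<U>"
    unfolding ultrafilter_on_def
  proof (intro conjI ballI allI impI)
    show "\<U> \<subseteq> Pow S" by (auto simp: \<U>_def)
    show "S \<in> \<U>" using W prime[of W] by (auto simp: \<U>_def PS W_def)
    show "{} \<notin> \<U>" using empty prime[of "{}"] by (simp add: \<U>_def P_def)
  next
    fix X Y assume "X \<in> \<U>" "Y \<in> \<U>"
    moreover have "- P (X \<inter> Y) = - P X \<union> - P Y" by (auto simp: P_def)
    ultimately show "X \<inter> Y \<in> \<U>" using un by (auto simp: \<U>_def)
  next
    fix X Y assume "X \<in> \<U>" "X \<subseteq> Y \<and> Y \<subseteq> S"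
    moreover from this have "- P Y \<subseteq> - P X" by (auto simp: P_def)
    ultimately show "Y \<in> \<U>" using sub by (auto simp: \<U>_def)
  next
    fix X assume "X \<subseteq> S"
    show "X \<in> \<U> \<or> S - X \<in> \<U>"
    proof (cases "- P X \<in> J")
      case True
      then show ?thesis using \<open>X \<subseteq> S\<close> by (simp add: \<U>_def)
    next
      case False
      then have "P X \<in> J" using prime by blast
      moreover have "- W \<in> J" using W prime W_def by blast
      moreover have "- P (S - X) = P X \<union> - W" using \<sigma> by (auto simp: P_def)
      ultimately show ?thesis using un by (auto simp: \<U>_def)
    qed
  qed
  have nonprincipal: "nonprincipal_on S \<U>"
    unfolding nonprincipal_on_def
  proof
    fix s assume "s \<in> S"
    have "P {s} \<subseteq> F s" using \<sigma> by (auto simp: P_def)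
    then have "P {s} \<in> J" using F[OF \<open>s \<in> S\<close>] sub by blast
    then show "{s} \<notin> \<U>" using prime[of "P {s}"] by (simp add: \<U>_def)
  qed
  have complete: "complete_below |S| \<U>"
    unfolding complete_below_def
  proof (intro allI impI, elim conjE)
    fix \<F> assume \<F>: "\<F> \<subseteq> \<U>" "\<F> \<noteq> {}" "|\<F>| <o |S|"
    \<comment> \<open>\<open>bad\<close> speaks of subsets of \<open>'a\<close>, so the family is
      re-indexed by a subset of \<open>S\<close> of the same size, which is not bad by
      minimality.\<close>
    then obtain j where j: "inj_on j \<F>" "j ` \<F> \<subseteq> S"
      using card_of_ordLeq[of \<F> S] ordLess_imp_ordLeq by blast
    have "|j ` \<F>| <o |S|" using card_of_image \<F>(3) ordLeq_ordLess_trans by blast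
    then have good: "\<not> bad (j ` \<F>)" using min not_ordLess_ordLeq by blast
    have "- P (the_inv_into \<F> j s) \<in> J" if "s \<in> j ` \<F>" for s
      using that \<F>(1) j(1) by (auto simp: \<U>_def the_inv_into_f_f)
    then have "(\<Union>s\<in>j ` \<F>. - P (the_inv_into \<F> j s)) \<in> J"
      using good[unfolded bad_def not_ex, THEN spec, of "\<lambda>s. - P (the_inv_into \<F> j s)"]
      by fast
    moreover have "- P (\<Inter>\<F>) \<subseteq> (\<Union>s\<in>j ` \<F>. - P (the_inv_into \<F> j s))"
      using \<F>(2) j(1) by (auto simp: P_def the_inv_into_f_f)
    ultimately have "- P (\<Inter>\<F>) \<in> J" using sub by blast
    then show "\<Inter>\<F> \<in> \<U>" using \<F>(1,2) by (auto simp: \<U>_def)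
  qed
  have "measurable_cardinal |S|"
    unfolding measurable_cardinal_def
    using uncountable ultra nonprincipal complete by (auto simp: Field_card_of card_of_card_order_on)
  then show ?thesis using min[OF \<open>bad I\<close>] by blast
qed

section \<open>Slenderness below the first measurable cardinal\<close>

text \<open>Vectors are indexed by the whole type, and \<open>outside\<close> makes \<open>g\<close>
  blind to coordinates off \<open>I\<close>; so the ideal consists of subsets of the type, as
  \<open>sigma_complete_prime_ideal_measurable\<close> expects.\<close>

lemma additive_eq_0_below_measurable:
  fixes g :: "('a \<Rightarrow> rat) \<Rightarrow> rat"
  assumes A_mult: "\<And>k x. x \<in> A \<Longrightarrow> of_int k * x \<in> A"
    and add: "\<And>x y. range x \<subseteq> A \<Longrightarrow> range y \<subseteq> A \<Longrightarrow> g (\<lambda>i. x i + y i) = g x + g y"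
    and R: "\<And>x. range x \<subseteq> A \<Longrightarrow> g x \<in> R"
    and red: "reduced_at q R" "reduced_at q' R" "coprime q q'" "q \<noteq> 0"
    and single: "\<And>a r. r \<in> A \<Longrightarrow> g (\<lambda>i. if i = a then r else 0) = 0"
    and outside: "\<And>x. range x \<subseteq> A \<Longrightarrow> (\<And>i. i \<in> I \<Longrightarrow> x i = 0) \<Longrightarrow> g x = 0"
    and small: "\<And>\<kappa> :: 'a rel. measurable_cardinal \<kappa> \<Longrightarrow> \<not> \<kappa> \<le>o |I|"
    and x: "range x \<subseteq> A"
  shows "g x = 0"
proof (rule ccontr)
  assume "g x \<noteq> 0"
  define piece where "piece \<nu> a n = (\<lambda>i. if \<nu> i = n then a i else 0)"
    for \<nu> :: "'a \<Rightarrow> nat" and a :: "'a \<Rightarrow> rat" and n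
  have pieces: "(\<forall>n. g (piece \<nu> a n) = 0) \<longrightarrow> g a = 0" "\<exists>n. g (piece \<nu> a n) = 0"
    if a: "range a \<subseteq> A" for \<nu> a
  proof -
    \<comment> \<open>Multiplying block \<open>n\<close> of \<open>a\<close> by \<open>c n\<close>
      turns \<open>g\<close> into an additive map on integer sequences: unit sequences give the
      pieces of \<open>a\<close>, the constant 1 gives \<open>g a\<close>.\<close>
    define \<phi> where "\<phi> c = g (\<lambda>i. of_int (c (\<nu> i)) * a i)" for c
    have mem: "range (\<lambda>i. of_int (c (\<nu> i)) * a i) \<subseteq> A" for c
      using a A_mult by blast
    have \<phi>_add: "\<phi> (\<lambda>n. c n + d n) = \<phi> c + \<phi> d" for c d
      unfolding \<phi>_def using add[OF mem[of c] mem[of d]] by (simp add: distrib_right)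
    have \<phi>_R: "\<phi> c \<in> R" for c unfolding \<phi>_def by (rule R[OF mem])
    have unit: "\<phi> (\<lambda>i. if i = n then 1 else 0) = g (piece \<nu> a n)" for n
      unfolding \<phi>_def piece_def by (rule arg_cong[of _ _ g]) auto
    have one: "\<phi> (\<lambda>_. 1) = g a" by (simp add: \<phi>_def)
    show "(\<forall>n. g (piece \<nu> a n) = 0) \<longrightarrow> g a = 0"
      using additive_seq_eq_0[of \<phi> R q q' "\<lambda>_. 1", OF \<phi>_add \<phi>_R red(1,2,3)] unit one by simp
    show "\<exists>n. g (piece \<nu> a n) = 0"
      using additive_seq_some_unit_eq_0[of \<phi> R q, OF \<phi>_add \<phi>_R red(1,4)] unit by simp
  qed
  define supported where "supported a X \<longleftrightarrow> range a \<subseteq> A \<and> (\<forall>i. i \<notin> X \<longrightarrow> a i = 0)"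
    for a :: "'a \<Rightarrow> rat" and X
  define J where "J = {X. \<forall>a. supported a X \<longrightarrow> g a = 0}"
  have "0 \<in> A" using A_mult[of "x undefined" 0] x by auto
  have sub: "Y \<in> J" if "X \<in> J" "Y \<subseteq> X" for X Y
    using that unfolding J_def supported_def by blast
  have sigma: "(\<Union>n. F n) \<in> J" if F: "\<And>n. F n \<in> J" for F :: "nat \<Rightarrow> 'a set"
    unfolding J_def
  proof (intro CollectI allI impI)
    fix a assume a: "supported a (\<Union>n. F n)"
    \<comment> \<open>Each index goes to the first \<open>F n\<close> containing it. Off the union
      the value is arbitrary, but \<open>a\<close> vanishes there.\<close>
    define \<nu> where "\<nu> i = (LEAST n. i \<in> F n)" for i
    have "supported (piece \<nu> a n) (F n)" for n
      unfolding supported_def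
    proof (intro conjI allI impI)
      show "range (piece \<nu> a n) \<subseteq> A"
        using a \<open>0 \<in> A\<close> by (auto simp: piece_def supported_def)
      fix i assume "i \<notin> F n"
      have "i \<in> F (\<nu> i)" if "i \<in> (\<Union>n. F n)"
        unfolding \<nu>_def using that by (auto intro: LeastI)
      then show "piece \<nu> a n i = 0"
        using \<open>i \<notin> F n\<close> a by (auto simp: piece_def supported_def)
    qed
    then have "g (piece \<nu> a n) = 0" for n using F by (auto simp: J_def)
    then show "g a = 0" using pieces(1)[of a \<nu>] a by (auto simp: supported_def)
  qed
  have un: "X \<union> Y \<in> J" if "X \<in> J" "Y \<in> J" for X Y
  proof -
    have "(\<Union>n::nat. if n = 0 then X else Y) \<in> J" using that by (intro sigma) auto
    then show ?thesis by (rule sub) (auto split: if_splits intro: exI[of _ 0] exI[of _ 1])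
  qed
  have singleton: "{a} \<in> J" for a
  proof -
    have "g b = 0" if b: "supported b {a}" for b
    proof -
      have "b = (\<lambda>i. if i = a then b a else 0)" using b by (auto simp: supported_def)
      moreover have "b a \<in> A" using b by (auto simp: supported_def)
      ultimately show ?thesis using single by metis
    qed
    then show ?thesis by (simp add: J_def)
  qed
  have no_disjoint: False
    if E: "\<And>n. E n \<notin> J" "\<And>m n. m < n \<Longrightarrow> E m \<inter> E n = {}" for E :: "nat \<Rightarrow> 'a set"
  proof -
    have "\<exists>b. supported b (E n) \<and> g b \<noteq> 0" for n using E(1)[of n] by (auto simp: J_def)
    then obtain b where b: "\<And>n. supported (b n) (E n)" "\<And>n. g (b n) \<noteq> 0" by metis
    define \<nu> where "\<nu> i = (LEAST n. i \<in> E n)" for i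
    have \<nu>: "\<nu> i = n" if "i \<in> E n" for i n
      unfolding \<nu>_def using that E(2) by (intro Least_equality) (auto simp: not_less[symmetric])
    \<comment> \<open>The glued vector agrees with \<open>b n\<close> on \<open>E n\<close> and
      vanishes off all of them, so its pieces are the \<open>b n\<close>, one of which
      \<open>g\<close> would have to kill.\<close>
    have "piece \<nu> (\<lambda>i. b (\<nu> i) i) n = b n" for n
      using b(1)[of n] \<nu>[of _ n] by (fastforce simp: piece_def supported_def fun_eq_iff)
    moreover have "range (\<lambda>i. b (\<nu> i) i) \<subseteq> A" using b(1) by (auto simp: supported_def)
    ultimately show False using pieces(2)[of "\<lambda>i. b (\<nu> i) i" \<nu>] b(2) by simp
  qed
  have "UNIV \<notin> J" using x \<open>g x \<noteq> 0\<close> by (auto simp: J_def supported_def)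
  \<comment> \<open>Without an atom, \<open>UNIV\<close> could be split forever outside
    \<open>J\<close>, and the parts \<open>X n - X (Suc n)\<close> split off would be an infinite
    disjoint family outside \<open>J\<close>.\<close>
  have "\<exists>X. X \<notin> J \<and> (\<forall>Y. X \<inter> Y \<in> J \<or> X - Y \<in> J)"
  proof (rule ccontr)
    assume "\<not> ?thesis"
    then have "\<forall>X. \<exists>Y. X \<notin> J \<longrightarrow> X \<inter> Y \<notin> J \<and> X - Y \<notin> J" by blast
    then obtain D where D: "\<And>X. X \<notin> J \<Longrightarrow> X \<inter> D X \<notin> J \<and> X - D X \<notin> J" by metis
    define X where "X = rec_nat UNIV (\<lambda>_ X. X \<inter> D X)"
    have XSuc: "X (Suc n) = X n \<inter> D (X n)" for n by (simp add: X_def)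
    have X: "X n \<notin> J" for n
      by (induction n) (use \<open>UNIV \<notin> J\<close> D XSuc in \<open>auto simp: X_def\<close>)
    have dec: "X n \<subseteq> X m" if "m \<le> n" for m n
      using that by (rule lift_Suc_antimono_le[rotated]) (simp add: XSuc)
    show False
    proof (rule no_disjoint)
      fix n
      have "X n - X (Suc n) = X n - D (X n)" by (auto simp: XSuc)
      then show "X n - X (Suc n) \<notin> J" using D[OF X[of n]] by simp
    next
      fix m n :: nat assume "m < n"
      then have "X n \<subseteq> X (Suc m)" by (intro dec) simp
      then show "(X m - X (Suc m)) \<inter> (X n - X (Suc n)) = {}" by blast
    qed
  qed
  then obtain X where X: "X \<notin> J" and atom: "\<And>Y. X \<inter> Y \<in> J \<or> X - Y \<in> J" by blast
  have "\<exists>\<kappa> :: 'a rel. measurable_cardinal \<kappa> \<and> \<kappa> \<le>o |I|"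
  \<comment> \<open>The ideal is cut down to the atom \<open>X\<close>: as \<open>X\<close> is not
    in \<open>J\<close>, exactly one of \<open>X \<inter> Y\<close> and \<open>X - Y\<close> is,
    which gives primeness.\<close>
  proof (rule sigma_complete_prime_ideal_measurable[of "{Y. X \<inter> Y \<in> J}"], unfold mem_Collect_eq)
    show "X \<inter> Z \<in> J" if "X \<inter> Y \<in> J" "Z \<subseteq> Y" for Y Z
      using that(1) by (rule sub) (use that(2) in blast)
    show "X \<inter> Y \<in> J \<longleftrightarrow> X \<inter> - Y \<notin> J" for Y
    proof -
      have "X = (X \<inter> Y) \<union> (X \<inter> - Y)" by blast
      then show ?thesis using un[of "X \<inter> Y" "X \<inter> - Y"] X atom[of Y] by (auto simp: Diff_eq)
    qed
    show "X \<inter> (\<Union>n. F n) \<in> J" if "\<And>n. X \<inter> F n \<in> J" for F :: "nat \<Rightarrow> 'a set"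
      using sigma[of "\<lambda>n. X \<inter> F n"] that by simp
    show "X \<inter> {a} \<in> J" for a using singleton[of a] by (rule sub) blast
    show "X \<inter> I \<notin> J"
    proof
      assume "X \<inter> I \<in> J"
      moreover have "- I \<in> J" using outside by (auto simp: J_def supported_def)
      ultimately have "(X \<inter> I) \<union> - I \<in> J" by (rule un)
      then show False using X sub by blast
    qed
  qed
  then show False using small by blast
qed

section \<open>Localization of the integers at a prime\<close>

text \<open>For prime \<open>q\<close> this is the localization at \<open>q\<close>. Asking for some
  denominator prime to \<open>q\<close>, not the reduced one, makes closure under sums and products
  easy.\<close>

definition local_at :: "int \<Rightarrow> rat set" where
  "local_at q = {x. \<exists>b. b \<noteq> 0 \<and> coprime b q \<and> of_int b * x \<in> \<int>}"

text \<open>If \<open>u / v\<close> is \<open>q ^ k\<close> times a fraction with denominator prime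
  to \<open>q\<close>, clearing denominators gives \<open>q ^ k dvd u\<close>. Only
  \<open>u = 0\<close> allows this for all \<open>k\<close>.\<close>

lemma reduced_at_local_at:
  assumes "prime q" "R \<subseteq> local_at q"
  shows "reduced_at q R"
  unfolding reduced_at_def
proof (intro allI impI)
  fix x :: rat assume div: "\<forall>k. \<exists>y\<in>R. x = of_int q ^ k * y"
  obtain u v where v: "v > 0" and x: "x = of_int u / of_int v"
    using quotient_of_div[of x] quotient_of_denom_pos[of x]
    by (metis prod.exhaust_sel)
  have "q ^ k dvd u" for k
  proof -
    obtain y where y: "y \<in> local_at q" "x = of_int q ^ k * y"
      using div assms(2) by blast
    then obtain b a where b: "coprime b q" and a: "of_int b * y = of_int a"
      by (auto simp: local_at_def elim!: Ints_cases)
    have "of_int b * x = of_int q ^ k * of_int a" using y(2) a by simp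
    then have "rat_of_int (b * u) = rat_of_int (v * (q ^ k * a))"
      using v by (simp add: x field_simps)
    then have "b * u = v * (q ^ k * a)" by (simp only: of_int_eq_iff)
    then have "q ^ k dvd b * u" by simp
    then show ?thesis
      using b by (simp add: coprime_commute coprime_dvd_mult_right_iff)
  qed
  then have "u = 0"
    using \<open>prime q\<close> by (metis finite_divisor_powers mem_Collect_eq not_prime_unit
        UNIV_eq_I infinite_UNIV_nat)
  then show "x = 0" by (simp add: x)
qed

lemma local_at_uminus: "x \<in> local_at q \<Longrightarrow> - x \<in> local_at q"
  by (auto simp: local_at_def)

lemma local_at_add:
  assumes "x \<in> local_at q" "y \<in> local_at q"
  shows "x + y \<in> local_at q"
proof -
  obtain b c where bc: "b \<noteq> 0" "coprime b q" "of_int b * x \<in> \<int>"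
    "c \<noteq> 0" "coprime c q" "of_int c * y \<in> \<int>"
    using assms by (auto simp: local_at_def)
  have "of_int (b * c) * (x + y) = of_int c * (of_int b * x) + of_int b * (of_int c * y)"
    by (simp add: algebra_simps)
  also have "\<dots> \<in> \<int>" by (intro Ints_add Ints_mult[OF Ints_of_int] bc)
  finally show ?thesis using bc unfolding local_at_def
    by (intro CollectI exI[of _ "b * c"]) simp
qed

lemma local_at_mult:
  assumes "x \<in> local_at q" "y \<in> local_at q"
  shows "x * y \<in> local_at q"
proof -
  obtain b c where bc: "b \<noteq> 0" "coprime b q" "of_int b * x \<in> \<int>"
    "c \<noteq> 0" "coprime c q" "of_int c * y \<in> \<int>"
    using assms by (auto simp: local_at_def)
  have "of_int (b * c) * (x * y) = (of_int b * x) * (of_int c * y)"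
    by (simp add: algebra_simps)
  also have "\<dots> \<in> \<int>" by (intro Ints_mult bc)
  finally show ?thesis using bc unfolding local_at_def
    by (intro CollectI exI[of _ "b * c"]) simp
qed

section \<open>The ring of rationals and its subrings \<open>Z_inv\<close>\<close>

lemma ring_rat_ring: "ring rat_ring"
proof (rule ringI)
  show "abelian_group rat_ring"
  proof (rule abelian_groupI)
    show "\<exists>y\<in>carrier rat_ring. y \<oplus>\<^bsub>rat_ring\<^esub> x = \<zero>\<^bsub>rat_ring\<^esub>" for x
      by (auto simp: rat_ring_def intro: exI[of _ "- x"])
  qed (auto simp: rat_ring_def)
  show "monoid rat_ring" by (rule monoidI) (auto simp: rat_ring_def)
qed (auto simp: rat_ring_def algebra_simps)

lemma a_inv_rat_ring: "\<ominus>\<^bsub>rat_ring\<^esub> x = - x"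
proof -
  interpret ring rat_ring by (rule ring_rat_ring)
  show ?thesis by (rule minus_equality) (auto simp: rat_ring_def)
qed

lemma Z_inv_closed:
  shows Z_inv_1: "1 \<in> Z_inv P"
    and Z_inv_uminus: "x \<in> Z_inv P \<Longrightarrow> - x \<in> Z_inv P"
    and Z_inv_add: "x \<in> Z_inv P \<Longrightarrow> y \<in> Z_inv P \<Longrightarrow> x + y \<in> Z_inv P"
    and Z_inv_mult: "x \<in> Z_inv P \<Longrightarrow> y \<in> Z_inv P \<Longrightarrow> x * y \<in> Z_inv P"
  using generate_ring.one[of rat_ring] generate_ring.a_inv[of x rat_ring]
    generate_ring.eng_add[of x rat_ring _ y] generate_ring.eng_mult[of x rat_ring _ y]
  by (auto simp: Z_inv_def a_inv_rat_ring) (auto simp: rat_ring_def)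

lemma Z_inv_0: "0 \<in> Z_inv P"
  using Z_inv_add[OF Z_inv_1 Z_inv_uminus[OF Z_inv_1]] by simp

lemma Z_inv_of_int: "of_int k \<in> Z_inv P"
proof (induction k)
  case (nonneg n)
  then show ?case by (induction n) (auto simp: Z_inv_0 intro: Z_inv_add Z_inv_1)
next
  case (neg n)
  have "rat_of_nat m \<in> Z_inv P" for m
    by (induction m) (auto simp: Z_inv_0 intro: Z_inv_add Z_inv_1)
  from Z_inv_uminus[OF this, of "Suc n"] show ?case by simp
qed

lemma Z_inv_mono: "P \<subseteq> Q \<Longrightarrow> Z_inv P \<subseteq> Z_inv Q"
proof
  fix x assume "P \<subseteq> Q" and "x \<in> Z_inv P"
  from this(2) show "x \<in> Z_inv Q"
    unfolding Z_inv_def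
    by (induction rule: generate_ring.induct) (use \<open>P \<subseteq> Q\<close> in \<open>auto intro: generate_ring.intros\<close>)
qed

text \<open>The generators \<open>1 / p\<close> have denominators prime to \<open>q\<close>, and the
  localization is closed under the ring operations. With \<open>reduced_at_local_at\<close> this
  yields reducedness at \<open>q\<close>.\<close>

lemma Z_inv_subset_local_at:
  assumes P: "\<And>p. p \<in> P \<Longrightarrow> prime p" and q: "prime q" "q \<notin> P"
  shows "Z_inv P \<subseteq> local_at (int q)"
proof
  fix x assume "x \<in> Z_inv P"
  then show "x \<in> local_at (int q)"
    unfolding Z_inv_def
  proof (induction rule: generate_ring.induct)
    case one
    show ?case by (auto simp: rat_ring_def local_at_def intro: exI[of _ 1])
  next
    case (incl h)
    then obtain p where "p \<in> P" and h: "h = 1 / of_nat p" by blast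
    then have "coprime (int p) (int q)" "p \<noteq> 0"
      using P[of p] q by (auto simp: coprime_int_iff intro: primes_coprime)
    then show ?case by (auto simp: h local_at_def intro!: exI[of _ "int p"])
  next
    case (a_inv h)
    then show ?case by (simp add: a_inv_rat_ring local_at_uminus)
  next
    case (eng_add h1 h2)
    then show ?case using local_at_add by (simp add: rat_ring_def)
  next
    case (eng_mult h1 h2)
    then show ?case using local_at_mult by (simp add: rat_ring_def)
  qed
qed

section \<open>Coordinate descriptions of \<open>U_group\<close> and \<open>M_set\<close>\<close>

lemma group_U: "group (U_group \<mu>)"
  unfolding U_group_def
  by (intro product_group abelian_group.a_group ring.is_abelian_group ring_rat_ring)

lemma carrier_U: "carrier (U_group \<mu>) = (\<Pi>\<^sub>E i\<in>Field \<mu>. UNIV)"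
  by (simp add: U_group_def rat_ring_def)

lemma mult_U: "x \<otimes>\<^bsub>U_group \<mu>\<^esub> y = (\<lambda>i\<in>Field \<mu>. x i + y i)"
  by (simp add: U_group_def rat_ring_def)

lemma one_U: "\<one>\<^bsub>U_group \<mu>\<^esub> = (\<lambda>i\<in>Field \<mu>. 0)"
  by (simp add: U_group_def rat_ring_def)

lemma inv_U: "x \<in> carrier (U_group \<mu>) \<Longrightarrow> inv\<^bsub>U_group \<mu>\<^esub> x = (\<lambda>i\<in>Field \<mu>. - x i)"
  by (rule group.inv_equality[OF group_U]) (auto simp: carrier_U mult_U one_U)

lemma M_set_eq:
  "M_set p\<^sub>1 p\<^sub>2 \<mu> = {x \<in> \<Pi>\<^sub>E i\<in>Field \<mu>. Z_inv {p\<^sub>1, p\<^sub>2}. finite {i \<in> Field \<mu>. x i \<noteq> 0}}"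
proof -
  \<comment> \<open>\<open>carrier_sum_group\<close> asks every factor to be a group, hence the
    detour through the subgroup property.\<close>
  interpret ring rat_ring by (rule ring_rat_ring)
  have "subgroup (Z_inv {p\<^sub>1, p\<^sub>2}) (add_monoid rat_ring)"
    by (intro add.subgroupI)
      (use Z_inv_1 in \<open>auto simp: a_inv_def[symmetric] a_inv_rat_ring Z_inv_uminus Z_inv_add,
        auto simp: rat_ring_def Z_inv_add\<close>)
  then have "group ((add_monoid rat_ring)\<lparr>carrier := Z_inv {p\<^sub>1, p\<^sub>2}\<rparr>)"
    by (rule subgroup.subgroup_is_group) (rule a_group)
  then show ?thesis
    by (simp add: M_set_def carrier_sum_group) (simp add: rat_ring_def)
qed

section \<open>Rigidity of \<open>N_group\<close>\<close>

theorem theorem4p10: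
  fixes p\<^sub>1 p\<^sub>2 :: nat
    and \<mu> :: "'a rel"
    and f :: "('a \<Rightarrow> rat) \<Rightarrow> ('a \<Rightarrow> rat)"
  assumes "prime p\<^sub>1" and "prime p\<^sub>2" and "p\<^sub>1 \<noteq> p\<^sub>2"
    and "Card_order \<mu>" and "regularCard \<mu>" and "natLeq <o \<mu>"
    and "below_first_measurable \<mu>"
    and "f \<in> hom (N_group p\<^sub>1 p\<^sub>2 \<mu>) (N_group p\<^sub>1 p\<^sub>2 \<mu>)"
    and "\<And>\<alpha>. \<alpha> \<in> Field \<mu> \<Longrightarrow> f (e_vec \<mu> \<alpha>) = e_vec \<mu> \<alpha>"
  shows "\<forall>x \<in> carrier (N_group p\<^sub>1 p\<^sub>2 \<mu>). f x = x"
proof -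
  define I where "I = Field \<mu>"
  define N where "N = carrier (N_group p\<^sub>1 p\<^sub>2 \<mu>)"
  define Z where "Z = Z_inv {p\<^sub>1, p\<^sub>2}"
  define M where "M = M_set p\<^sub>1 p\<^sub>2 \<mu>"
  define P where "P = (\<Pi>\<^sub>E i\<in>I. Z_inv {p\<^sub>2})"
  note e = assms(9)[folded I_def]
  have Z2: "Z_inv {p\<^sub>2} \<subseteq> Z" unfolding Z_def by (rule Z_inv_mono) simp
  have M_eq: "M = {x \<in> \<Pi>\<^sub>E i\<in>I. Z. finite {i \<in> I. x i \<noteq> 0}}"
    by (simp add: M_def M_set_eq I_def Z_def)
  \<comment> \<open>\<open>subgroup_generated\<close> intersects the generators with the carrier;
    here they already lie in it.\<close>
  have N_eq: "N = generate (U_group \<mu>) (M \<union> P)"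
    unfolding N_def N_group_def carrier_subgroup_generated M_def[symmetric] P_def I_def
    by (rule arg_cong[of _ _ "generate _"]) (auto simp: carrier_U M_eq I_def)
  have MN: "M \<subseteq> N" and PN: "P \<subseteq> N" unfolding N_eq by (auto intro: generate.incl)
  have MP: "M \<union> P \<subseteq> carrier (U_group \<mu>)"
    by (auto simp: carrier_U M_eq P_def I_def)
  have N_Z: "N \<subseteq> (\<Pi>\<^sub>E i\<in>I. Z)"
  proof
    fix x assume "x \<in> N"
    then show "x \<in> (\<Pi>\<^sub>E i\<in>I. Z)"
      unfolding N_eq
    proof (induction rule: generate.induct)
      case one
      show ?case by (auto simp: one_U I_def Z_def Z_inv_0)
    next
      case (incl h)
      then show ?case using Z2 by (auto simp: M_eq P_def PiE_iff)
    next
      case (inv h)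
      then have "h \<in> carrier (U_group \<mu>)" "h \<in> (\<Pi>\<^sub>E i\<in>I. Z)"
        using MP Z2 by (blast, auto simp: M_eq P_def PiE_iff)
      then show ?case by (auto simp: inv_U I_def Z_def intro!: Z_inv_uminus)
    next
      case (eng h1 h2)
      then show ?case by (auto simp: mult_U I_def Z_def intro!: Z_inv_add)
    qed
  qed
  have f_N: "f x \<in> N" if "x \<in> N" for x
    using assms(8) that unfolding hom_def N_def by auto
  have f_add: "f (\<lambda>i\<in>I. x i + y i) = (\<lambda>i\<in>I. f x i + f y i)" if "x \<in> N" "y \<in> N" for x y
    using assms(8) that unfolding hom_def N_def I_def
    by (auto simp: N_group_def mult_U)
  define v where "v a r = (\<lambda>i\<in>I. if i = a then r else 0)" for a :: 'a and r :: rat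
  have v_M: "v a r \<in> M" if "r \<in> Z" for a r
  proof -
    have "{i \<in> I. v a r i \<noteq> 0} \<subseteq> {a}" by (auto simp: v_def)
    then have "finite {i \<in> I. v a r i \<noteq> 0}" by (rule finite_subset) simp
    then show ?thesis using that Z_inv_0 by (auto simp: M_eq v_def Z_def)
  qed
  \<comment> \<open>With \<open>r = c / b\<close>, additivity gives \<open>b\<close> times the image
    of \<open>v a r\<close> as \<open>c\<close> times that of \<open>e_vec \<mu> a\<close>; in
    rational coordinates \<open>b\<close> cancels.\<close>
  have f_v: "f (v a r) = v a r" if a: "a \<in> I" and r: "r \<in> Z" for a r
  proof
    fix i
    have v_e: "v a 1 = e_vec \<mu> a" by (auto simp: v_def e_vec_def I_def)
    obtain c b where b: "b > 0" and rb: "r = of_int c / of_int b"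
      using quotient_of_div[of r] quotient_of_denom_pos[of r] by (metis prod.exhaust_sel)
    show "f (v a r) i = v a r i"
    proof (cases "i \<in> I")
      case True
      have scale: "f (v a (of_int k * s)) i = of_int k * f (v a s) i" if s: "s \<in> Z" for k s
      proof -
        \<comment> \<open>Only entry 0 of \<open>c\<close> matters: a map on the integers is dressed
          as one on sequences so that \<open>additive_seq_int_mult\<close> applies.\<close>
        define \<phi> where "\<phi> c = f (v a (of_int (c 0) * s)) i" for c :: "nat \<Rightarrow> int"
        have mem: "v a (of_int m * s) \<in> N" for m
          using MN s by (auto intro!: v_M Z_inv_mult Z_inv_of_int simp: Z_def)
        have "\<phi> (\<lambda>n. c n + d n) = \<phi> c + \<phi> d" for c d
        proof -
          have "v a (of_int (c 0 + d 0) * s) =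
              (\<lambda>i\<in>I. v a (of_int (c 0) * s) i + v a (of_int (d 0) * s) i)"
            by (auto simp: v_def distrib_right)
          then show ?thesis using f_add[OF mem[of "c 0"] mem[of "d 0"]] True
            by (simp add: \<phi>_def)
        qed
        from additive_seq_int_mult[of \<phi>, OF this, of k "\<lambda>_. 1"] show ?thesis
          by (simp add: \<phi>_def)
      qed
      have "of_int b * r = of_int c * 1" using b rb by simp
      then have "of_int b * f (v a r) i = of_int c * f (v a 1) i"
        using scale[OF r, of b] scale[of 1 c] Z_inv_1 by (simp add: Z_def)
      then have "f (v a r) i = r * v a 1 i"
        using b by (simp add: rb v_e e[OF a] field_simps)
      then show ?thesis by (simp add: v_def True)
    next
      case False
      moreover have "f (v a r) \<in> (\<Pi>\<^sub>E i\<in>I. Z)" using f_N N_Z v_M[OF r] MN by blast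
      ultimately show ?thesis by (simp add: v_def PiE_arb[of _ I "\<lambda>_. Z"])
    qed
  qed
  have f_zero: "f (\<lambda>i\<in>I. 0) = (\<lambda>i\<in>I. 0)"
  proof -
    define z :: "'a \<Rightarrow> rat" where "z = (\<lambda>i\<in>I. 0)"
    have z: "z \<in> N"
      using generate.one[of "U_group \<mu>" "M \<union> P"] by (simp add: N_eq one_U I_def z_def)
    have "(\<lambda>i\<in>I. z i + z i) = z" by (auto simp: z_def)
    then have twice: "f z = (\<lambda>i\<in>I. f z i + f z i)" using f_add[OF z z] by simp
    have "f z = z"
    proof (rule PiE_ext)
      show "f z \<in> (\<Pi>\<^sub>E i\<in>I. Z)" "z \<in> (\<Pi>\<^sub>E i\<in>I. Z)" using z f_N N_Z by blast+
      show "f z i = z i" if "i \<in> I" for i using fun_cong[OF twice, of i] that by (simp add: z_def)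
    qed
    then show ?thesis by (simp add: z_def)
  qed
  have f_M: "f x = x" if "x \<in> M" for x
  proof -
    \<comment> \<open>Induction over a finite set containing the support, splitting off one
      coordinate at a time. \<open>F\<close> may leave \<open>I\<close>, hence the case distinction
      on \<open>a\<close>.\<close>
    have "f x = x" if "finite F" "x \<in> (\<Pi>\<^sub>E i\<in>I. Z)" "{i \<in> I. x i \<noteq> 0} \<subseteq> F" for F x
      using that
    proof (induction F arbitrary: x rule: finite_induct)
      case empty
      then have "x = (\<lambda>i\<in>I. 0)" by (auto simp: PiE_iff extensional_def fun_eq_iff)
      then show ?case using f_zero by metis
    next
      case (insert a F)
      show ?case
      proof (cases "a \<in> I")
        case True
        define y where "y = x(a := 0)"
        have y: "y \<in> (\<Pi>\<^sub>E i\<in>I. Z)" "{i \<in> I. y i \<noteq> 0} \<subseteq> F"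
          using insert.prems True by (auto simp: y_def Z_def Z_inv_0 PiE_iff extensional_def)
        then have "y \<in> N"
          using MN insert.hyps(1) by (auto simp: M_eq intro: finite_subset)
        have xa: "x a \<in> Z" using insert.prems True by auto
        have x: "x = (\<lambda>i\<in>I. y i + v a (x a) i)"
          using insert.prems by (auto simp: y_def v_def PiE_iff extensional_def fun_eq_iff)
        have "f x = (\<lambda>i\<in>I. f y i + f (v a (x a)) i)"
          using f_add[OF \<open>y \<in> N\<close>, of "v a (x a)"] v_M[OF xa] MN x by auto
        also have "\<dots> = x" using insert.IH[OF y] f_v[OF True xa] x by simp
        finally show ?thesis .
      next
        case False
        then show ?thesis using insert by blast
      qed
    qed
    then show ?thesis using that by (auto simp: M_eq)
  qed
  have f_P: "f x = x" if x: "x \<in> P" for x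
  proof (rule PiE_ext)
    show "x \<in> (\<Pi>\<^sub>E i\<in>I. Z)" "f x \<in> (\<Pi>\<^sub>E i\<in>I. Z)" using x PN N_Z f_N by blast+
    fix j assume j: "j \<in> I"
    define A where "A = Z_inv {p\<^sub>2}"
    \<comment> \<open>This is coordinate \<open>j\<close> of \<open>f - id\<close>, made total by
      restricting to \<open>I\<close>.\<close>
    define g where "g y = f (restrict y I) j - y j" for y
    have restrict_N: "restrict y I \<in> N" if "range y \<subseteq> A" for y
    proof -
      have "restrict y I \<in> P" using that by (auto simp: P_def A_def)
      then show ?thesis using PN by blast
    qed
    \<comment> \<open>Two distinct further primes are chosen: \<open>Z\<close> is reduced at both,
      and they are coprime.\<close>
    have "infinite ({p :: nat. prime p} - {p\<^sub>1, p\<^sub>2})"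
      using primes_infinite by simp
    then obtain q where q: "prime q" "q \<notin> {p\<^sub>1, p\<^sub>2}"
      by (metis (no_types, lifting) DiffE finite.emptyI mem_Collect_eq ex_in_conv)
    have "infinite ({p :: nat. prime p} - {p\<^sub>1, p\<^sub>2, q})"
      using primes_infinite by simp
    then obtain q' where q': "prime q'" "q' \<notin> {p\<^sub>1, p\<^sub>2, q}"
      by (metis (no_types, lifting) DiffE finite.emptyI mem_Collect_eq ex_in_conv)
    \<comment> \<open>Off \<open>I\<close> the value of \<open>x\<close> is
      \<open>undefined\<close>; replacing it by 0 keeps all entries in \<open>A\<close>.\<close>
    have "g (\<lambda>i. if i \<in> I then x i else 0) = 0"
    proof (rule additive_eq_0_below_measurable[of A g Z "int q" "int q'" I])
      show "of_int k * y \<in> A" if "y \<in> A" for k y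
        using that by (simp add: A_def Z_inv_mult Z_inv_of_int)
      show "g (\<lambda>i. y i + z i) = g y + g z" if y: "range y \<subseteq> A" and z: "range z \<subseteq> A" for y z
      proof -
        have "restrict (\<lambda>i. y i + z i) I = (\<lambda>i\<in>I. restrict y I i + restrict z I i)" by auto
        then show ?thesis
          using f_add[OF restrict_N[OF y] restrict_N[OF z]] j by (simp add: g_def)
      qed
      show "g y \<in> Z" if y: "range y \<subseteq> A" for y
      proof -
        have "f (restrict y I) j \<in> Z" using f_N[OF restrict_N[OF y]] N_Z j by blast
        moreover have "- y j \<in> Z" using y Z2 by (auto simp: A_def Z_def intro!: Z_inv_uminus)
        ultimately show ?thesis unfolding g_def Z_def using Z_inv_add by fastforce
      qed
      show "reduced_at (int q) Z" "reduced_at (int q') Z"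
        unfolding Z_def using assms(1,2) q q'
        by (intro reduced_at_local_at Z_inv_subset_local_at; auto)+
      show "coprime (int q) (int q')"
        using q q' by (auto simp: coprime_int_iff intro!: primes_coprime)
      show "int q \<noteq> 0" using q by auto
      have f_restrict_0: "g y = 0" if "\<And>i. i \<in> I \<Longrightarrow> y i = 0" for y
      proof -
        have "restrict y I = (\<lambda>i\<in>I. 0)" using that by auto
        then have "f (restrict y I) = (\<lambda>i\<in>I. 0)" using f_zero by metis
        then show ?thesis using j that by (simp add: g_def)
      qed
      then show "g y = 0" if "range y \<subseteq> A" "\<And>i. i \<in> I \<Longrightarrow> y i = 0" for y
        using that by blast
      show "g (\<lambda>i. if i = a then r else 0) = 0" if "r \<in> A" for a r
      proof (cases "a \<in> I")
        case True
        have "r \<in> Z" using that Z2 A_def by blast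
        then show ?thesis using f_v[OF True, of r] j by (simp add: g_def v_def)
      next
        case False
        then show ?thesis by (intro f_restrict_0) auto
      qed
      show "\<not> \<kappa> \<le>o |I|" if "measurable_cardinal \<kappa>" for \<kappa> :: "'a rel"
      proof
        assume "\<kappa> \<le>o |I|"
        moreover have "|I| =o \<mu>" unfolding I_def by (rule card_of_Field_ordIso) (rule assms(4))
        ultimately have "\<kappa> \<le>o \<mu>" by (rule ordLeq_ordIso_trans)
        then show False using that assms(7) by (auto simp: below_first_measurable_def)
      qed
      show "range (\<lambda>i. if i \<in> I then x i else 0) \<subseteq> A"
        using x Z_inv_0 by (auto simp: P_def A_def)
    qed
    moreover have "restrict (\<lambda>i. if i \<in> I then x i else 0) I = x"
      using x by (auto simp: P_def PiE_iff extensional_def fun_eq_iff)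
    ultimately show "f x j = x j" using j by (simp add: g_def)
  qed
  have "f x = x" if "x \<in> N" for x
    using that unfolding N_eq
  proof (induction rule: generate.induct)
    case one
    show ?case using f_zero unfolding one_U I_def .
  next
    case (incl h)
    then show ?case using f_M f_P by blast
  next
    case (inv h)
    \<comment> \<open>\<open>M\<close> and \<open>P\<close> are closed under negation, so the
      inverse of a generator is covered by \<open>f_M\<close> and \<open>f_P\<close>.\<close>
    have "(\<lambda>i\<in>I. - h i) \<in> M \<union> P"
      using inv by (auto simp: M_eq P_def Z_def intro!: Z_inv_uminus cong: conj_cong)
    moreover have "inv\<^bsub>U_group \<mu>\<^esub> h = (\<lambda>i\<in>I. - h i)"
      unfolding I_def using inv MP by (intro inv_U) blast
    ultimately show ?case using f_M f_P by (metis Un_iff)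
  next
    case (eng h1 h2)
    then have "h1 \<in> N" "h2 \<in> N" by (simp_all add: N_eq)
    then show ?case unfolding mult_U I_def[symmetric] using f_add[of h1 h2] eng.IH by metis
  qed
  then show ?thesis by (simp add: N_def)
qed

end
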